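(* For all integers $q \ge 3$ and $n \ge 3$, the set $\mathcal{CBFS}_q(n) = \mathcal{A}_q(n) \cup \mathcal{B}_q(n) \cup \mathcal{C}_q(n)$ is a cross-bifix-free set on $BF_q(n)$; that is, $\mathcal{CBFS}_q(n) \subseteq BF_q(n)$ and any two distinct words of $\mathcal{CBFS}_q(n)$ are cross-bifix-free.
   Context: Words. $\mathbb{Z}_q = \{0,1,\dots,q-1\}$ is an alphabet of $q$ letters and $\mathbb{Z}_q^n$ is the set of words of length $n$ over it. A word $w \in \mathbb{Z}_q^n$ is bifix-free if no non-empty proper prefix of $w$ is also a suffix of $w$. $BF_q(n)$ is the set of all bifix-free words in $\mathbb{Z}_q^n$. Two distinct words $w,w' \in BF_q(n)$ are cross-bifix-free if no non-empty strict (proper) prefix of $w$ is a suffix of $w'$ and no non-empty strict prefix of $w'$ is a suffix of $w$. A subset of $BF_q(n)$ is a cross-bifix-free set if any two distinct words in it are cross-bifix-free. Motzkin words. Words are read as lattice paths starting at $(0,0)$: the letter $0$ is a fall step $(1,-1)$, the letter $1$ is a rise step $(1,1)$, and each of the letters $2,\dots,q-1$ is a level step $(1,0)$ carrying one of $q-2$ colors (distinct letters, distinct colors). $\mathcal{M}_{q-2}(m)$ denotes the set of $(q-2)$-colored Motzkin words of length $m \ge 0$: the words in $\mathbb{Z}_q^m$ whose path ends at $(m,0)$ and never goes below the $x$-axis (for $m=0$, only the empty word). For $m \ge 2$, the set of elevated $(q-2)$-colored Motzkin words of length $m$ is $\hat{\mathcal{M}}_{q-2}(m) = \{1\alpha 0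 : \alpha \in \mathcal{M}_{q-2}(m-2)\}$. The sets. For $q\ge 3$, $n \ge 3$ (juxtaposition is concatenation): $\mathcal{A}_q(n) = \{\alpha\beta : \alpha \in \mathcal{M}_{q-2}(i),\ \beta \in \hat{\mathcal{M}}_{q-2}(n-i),\ 0 \le i \le \lfloor n/2 \rfloor\} \setminus \{\alpha\beta : \alpha,\beta \in \hat{\mathcal{M}}_{q-2}(n/2)\}$, where the removed set is taken to be empty if $n$ is odd; $\mathcal{B}_q(n) = \{1\alpha\beta : \alpha \in \mathcal{M}_{q-2}(i),\ \beta \in \hat{\mathcal{M}}_{q-2}(n-i-1),\ 0 \le i \le \lfloor n/2 \rfloor - 1\}$; $\mathcal{C}_q(n)$ is the set of words $\gamma 0$ with $\gamma \in \mathcal{M}_{q-2}(n-1)$ such that $\gamma$ cannot be written as $\gamma = u\beta v$ with $u,v$ (possibly empty) words and $\beta \in \hat{\mathcal{M}}_{q-2}(j)$ for some $j \ge \lceil n/2 \rceil$. *)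

theory Defs
  imports Main "HOL-Library.Sublist"
begin

definition words :: "nat \<Rightarrow> nat \<Rightarrow> nat list set" where
  "words q n = {w. set w \<subseteq> {..<q} \<and> length w = n}"

definition bifix_free :: "'a list \<Rightarrow> bool" where
  "bifix_free w \<longleftrightarrow> \<not> (\<exists>p. p \<noteq> [] \<and> strict_prefix p w \<and> suffix p w)"

definition BF :: "nat \<Rightarrow> nat \<Rightarrow> nat list set" where
  "BF q n = {w \<in> words q n. bifix_free w}"

definition cross_bifix_free :: "'a list \<Rightarrow> 'a list \<Rightarrow> bool" where
  "cross_bifix_free w w' \<longleftrightarrow>
     \<not> (\<exists>p. p \<noteq> [] \<and> strict_prefix p w \<and> suffix p w') \<and>
     \<not> (\<exists>p. p \<noteq> [] \<and> strict_prefix p w' \<and> suffix p w)"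

definition cross_bifix_free_set :: "nat \<Rightarrow> nat \<Rightarrow> nat list set \<Rightarrow> bool" where
  "cross_bifix_free_set q n S \<longleftrightarrow>
     S \<subseteq> BF q n \<and> (\<forall>w\<in>S. \<forall>w'\<in>S. w \<noteq> w' \<longrightarrow> cross_bifix_free w w')"

definition step :: "nat \<Rightarrow> int" where
  "step a = (if a = 0 then -1 else if a = 1 then 1 else 0)"

definition height :: "nat list \<Rightarrow> int" where
  "height w = sum_list (map step w)"

text \<open>The first argument of \<open>motzkin\<close> and \<open>elevated\<close> is the alphabet size \<open>q\<close>,
  so that the number of colors of level steps is \<open>q - 2\<close>.\<close>

definition motzkin :: "nat \<Rightarrow> nat \<Rightarrow> nat list set" where
  "motzkin q m = {w \<in> words q m. height w = 0 \<and> (\<forall>k\<le>m. 0 \<le> height (take k w))}"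

definition elevated :: "nat \<Rightarrow> nat \<Rightarrow> nat list set" where
  "elevated q m = {[1] @ \<alpha> @ [0] | \<alpha>. 2 \<le> m \<and> \<alpha> \<in> motzkin q (m - 2)}"

definition setA :: "nat \<Rightarrow> nat \<Rightarrow> nat list set" where
  "setA q n =
     {\<alpha> @ \<beta> | \<alpha> \<beta> i. i \<le> n div 2 \<and> \<alpha> \<in> motzkin q i \<and> \<beta> \<in> elevated q (n - i)}
     - {\<alpha> @ \<beta> | \<alpha> \<beta>. even n \<and> \<alpha> \<in> elevated q (n div 2) \<and> \<beta> \<in> elevated q (n div 2)}"

definition setB :: "nat \<Rightarrow> nat \<Rightarrow> nat list set" where
  "setB q n =
     {[1] @ \<alpha> @ \<beta> | \<alpha> \<beta> i. i \<le> n div 2 - 1 \<and> \<alpha> \<in> motzkin q i \<and> \<beta> \<in> elevated q (n - i - 1)}"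

text \<open>Below, \<open>(n + 1) div 2\<close> is the ceiling of \<open>n / 2\<close>.\<close>

definition setC :: "nat \<Rightarrow> nat \<Rightarrow> nat list set" where
  "setC q n =
     {\<gamma> @ [0] | \<gamma>. \<gamma> \<in> motzkin q (n - 1) \<and>
        \<not> (\<exists>u \<beta> v j. (n + 1) div 2 \<le> j \<and> \<beta> \<in> elevated q j \<and> \<gamma> = u @ \<beta> @ v)}"

definition CBFS :: "nat \<Rightarrow> nat \<Rightarrow> nat list set" where
  "CBFS q n = setA q n \<union> setB q n \<union> setC q n"

end

theory Submission
  imports Defs
begin

text \<open>
  Suppose \<open>p\<close> is a non-empty strict prefix of \<open>w\<close> and a suffix of \<open>w'\<close>. Every strict prefix has
  height at least 0 and every strict suffix has height at most 0, so \<open>p\<close> has height 0. A suffix of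
  non-negative height cannot start strictly inside the final elevated block of \<open>w'\<close>, hence it ends
  with an elevated word of length at least \<open>\<lceil>n/2\<rceil>\<close>. No strict prefix of height 0 does so: in
  \<open>A\<close> such a prefix lies in the first factor, which has length at most \<open>\<lfloor>n/2\<rfloor>\<close>, and the
  only borderline case is the removed set; in \<open>B\<close> strict non-empty prefixes have positive
  height; in \<open>C\<close> long elevated factors are forbidden.
\<close>

section \<open>Heights and Motzkin words\<close>

lemma height_simps [simp]:
  "height [] = 0"
  "height (a # w) = step a + height w"
  "height (v @ w) = height v + height w"
  by (simp_all add: height_def)

text \<open>Quantifying over prefixes instead of \<open>take k w\<close> lets
  \<open>prefix_append\<close> split a prefix of a concatenation into cases.\<close>

lemma motzkin_iff:
  "w \<in> motzkin q m \<longleftrightarrow>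
     w \<in> words q m \<and> height w = 0 \<and> (\<forall>p. prefix p w \<longrightarrow> 0 \<le> height p)"
proof -
  have "(\<forall>k\<le>length w. 0 \<le> height (take k w)) \<longleftrightarrow> (\<forall>p. prefix p w \<longrightarrow> 0 \<le> height p)"
    by (metis append_eq_conv_conj prefix_def prefix_length_le take_is_prefix)
  then show ?thesis
    by (auto simp: motzkin_def words_def)
qed

lemma words_append: "v \<in> words q i \<Longrightarrow> w \<in> words q j \<Longrightarrow> v @ w \<in> words q (i + j)"
  by (auto simp: words_def)

lemma motzkin_append:
  "\<alpha> \<in> motzkin q i \<Longrightarrow> \<beta> \<in> motzkin q j \<Longrightarrow> \<alpha> @ \<beta> \<in> motzkin q (i + j)"
  by (auto simp: motzkin_iff words_append prefix_append)

section \<open>Prefixes and suffixes of elevated words\<close>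

lemma elevated_length: "\<beta> \<in> elevated q m \<Longrightarrow> length \<beta> = m"
  by (auto simp: elevated_def motzkin_def words_def)

lemma elevated_height: "\<beta> \<in> elevated q m \<Longrightarrow> height \<beta> = 0"
  by (auto simp: elevated_def motzkin_def step_def)

text \<open>The leading rise lifts every prefix of the inner Motzkin word by one, and the closing
  fall occurs only in the full word.\<close>

lemma elevated_prefix_height:
  assumes "\<beta> \<in> elevated q m" "strict_prefix p \<beta>" "p \<noteq> []"
  shows "1 \<le> height p"
proof -
  obtain \<alpha> where \<alpha>: "\<beta> = 1 # \<alpha> @ [0]" "\<alpha> \<in> motzkin q (m - 2)"
    using assms(1) by (auto simp: elevated_def)
  obtain p' where p': "p = 1 # p'" "strict_prefix p' (\<alpha> @ [0])"
    using assms(2,3) \<alpha>(1) by (cases p) auto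
  then have "prefix p' \<alpha>"
    by (metis prefix_order.less_le prefix_snoc)
  then show ?thesis
    using \<alpha>(2) p' by (auto simp: motzkin_iff step_def)
qed

lemma elevated_motzkin:
  assumes "2 \<le> q" "\<beta> \<in> elevated q m"
  shows "\<beta> \<in> motzkin q m"
proof -
  \<comment> \<open>The bound on \<open>q\<close> puts the added letters 1 and 0 into the
    alphabet.\<close>
  have "\<beta> \<in> words q m"
    using assms by (auto simp: elevated_def motzkin_def words_def)
  moreover have "0 \<le> height p" if "prefix p \<beta>" for p
    using that elevated_prefix_height[OF assms(2), of p] elevated_height[OF assms(2)]
    by (cases "p = [] \<or> p = \<beta>") (auto simp: strict_prefix_def)
  ultimately show ?thesis
    using elevated_height[OF assms(2)] by (simp add: motzkin_iff)
qed

text \<open>If \<open>p\<close> started strictly inside \<beta>, it would have to undo the positive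
  height of the part of \<beta> before it, and so be negative.\<close>

lemma elevated_suffix:
  assumes "\<beta> \<in> elevated q m" "suffix p (x @ \<beta>)" "p \<noteq> []" "0 \<le> height p"
  shows "suffix \<beta> p"
proof (rule ccontr)
  assume "\<not> suffix \<beta> p"
  then have "suffix p \<beta>" "p \<noteq> \<beta>"
    using assms(2) by (auto simp: suffix_append)
  then obtain u where u: "\<beta> = u @ p" "u \<noteq> []"
    by (auto simp: suffix_def)
  then have "1 \<le> height u"
    using assms by (intro elevated_prefix_height) (auto simp: strict_prefix_def)
  then show False
    using elevated_height[OF assms(1)] assms(4) u by simp
qed

text \<open>A prefix that enters \<beta> without exhausting it gains positive height there, while
  \<alpha> contributes 0.\<close>

lemma motzkin_elevated_zero_prefix:
  assumes "\<alpha> \<in> motzkin q i" "\<beta> \<in> elevated q j" "strict_prefix p (\<alpha> @ \<beta>)" "height p = 0"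
  shows "prefix p \<alpha>"
proof (rule ccontr)
  assume "\<not> prefix p \<alpha>"
  then obtain u where "p = \<alpha> @ u" "prefix u \<beta>" "u \<noteq> []"
    using assms(3) by (auto simp: strict_prefix_def prefix_append)
  moreover from this have "strict_prefix u \<beta>"
    using assms(3) by (auto simp: strict_prefix_def)
  ultimately show False
    using elevated_prefix_height[OF assms(2), of u] assms(1,4) by (auto simp: motzkin_iff)
qed

section \<open>Prefixes and suffixes in the three families\<close>

lemma setA_motzkin:
  assumes "2 \<le> q" "w \<in> setA q n"
  shows "w \<in> motzkin q n"
proof -
  obtain \<alpha> \<beta> i where "w = \<alpha> @ \<beta>" "i \<le> n div 2" "\<alpha> \<in> motzkin q i" "\<beta> \<in> elevated q (n - i)"
    using assms(2) by (auto simp: setA_def)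
  then show ?thesis
    using motzkin_append[of \<alpha> q i \<beta> "n - i"] elevated_motzkin[OF assms(1)] by auto
qed

lemma setB_motzkin:
  assumes "2 \<le> q" "2 \<le> n" "w \<in> setB q n"
  obtains \<gamma> where "w = 1 # \<gamma>" "\<gamma> \<in> motzkin q (n - 1)"
proof -
  obtain \<alpha> \<beta> i where "w = 1 # \<alpha> @ \<beta>" "i \<le> n div 2 - 1"
    "\<alpha> \<in> motzkin q i" "\<beta> \<in> elevated q (n - i - 1)"
    using assms(3) by (auto simp: setB_def)
  moreover from this have "i + (n - i - 1) = n - 1"
    using assms(2) by linarith
  ultimately show ?thesis
    using that motzkin_append[of \<alpha> q i \<beta> "n - i - 1"] elevated_motzkin[OF assms(1)] by auto
qed

lemma CBFS_words:
  assumes "2 \<le> q" "2 \<le> n" "w \<in> CBFS q n"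
  shows "w \<in> words q n"
  using assms(3) unfolding CBFS_def
proof (elim UnE)
  assume "w \<in> setA q n"
  then show ?thesis
    using setA_motzkin[OF assms(1)] by (simp add: motzkin_iff)
next
  assume "w \<in> setB q n"
  then show ?thesis
    using assms(1,2) by (auto elim!: setB_motzkin[OF assms(1,2)] simp: motzkin_iff words_def)
next
  assume "w \<in> setC q n"
  then show ?thesis
    using assms(1,2) by (auto simp: setC_def motzkin_iff words_def)
qed

text \<open>A strict suffix of a Motzkin word has height at most 0, as what precedes it is
  non-negative. In \<open>setB\<close> a strict suffix misses the initial rise; in
  \<open>setC\<close> the final fall only lowers the height.\<close>

lemma CBFS_suffix_height:
  assumes "2 \<le> q" "2 \<le> n" "w \<in> CBFS q n" "strict_suffix p w"
  shows "height p \<le> 0"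
proof -
  obtain u where u: "w = u @ p" "u \<noteq> []"
    using assms(4) by (auto simp: strict_suffix_def suffix_def)
  from assms(3) show ?thesis
    unfolding CBFS_def
  proof (elim UnE)
    assume "w \<in> setA q n"
    then have "height w = 0" "0 \<le> height u"
      using setA_motzkin[OF assms(1), of w n] u(1) by (simp_all add: motzkin_iff)
    then show ?thesis
      using u by simp
  next
    assume "w \<in> setB q n"
    then obtain \<gamma> where \<gamma>: "w = 1 # \<gamma>" "\<gamma> \<in> motzkin q (n - 1)"
      using setB_motzkin[OF assms(1,2)] by blast
    then obtain u' where "\<gamma> = u' @ p"
      using u by (cases u) auto
    then show ?thesis
      using \<gamma>(2) by (auto simp: motzkin_iff dest: spec[of _ u'])
  next
    assume "w \<in> setC q n"
    then obtain \<gamma> where \<gamma>: "w = \<gamma> @ [0]" "\<gamma> \<in> motzkin q (n - 1)"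
      by (auto simp: setC_def)
    show ?thesis
    proof (cases p rule: rev_cases)
      case (snoc p' a)
      then have "\<gamma> = u @ p'" "a = 0"
        using u \<gamma>(1) by auto
      then show ?thesis
        using \<gamma>(2) snoc by (auto simp: motzkin_iff step_def dest: spec[of _ u])
    qed simp
  qed
qed

lemma CBFS_suffix_elevated:
  assumes "2 \<le> n" "w \<in> CBFS q n" "suffix p w" "p \<noteq> []" "0 \<le> height p"
  obtains \<beta> j where "(n + 1) div 2 \<le> j" "\<beta> \<in> elevated q j" "suffix \<beta> p"
  using assms(2) unfolding CBFS_def
proof (elim UnE)
  assume "w \<in> setA q n"
  then obtain \<alpha> \<beta> i where "w = \<alpha> @ \<beta>" "i \<le> n div 2" "\<beta> \<in> elevated q (n - i)"
    by (auto simp: setA_def)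
  \<comment> \<open>Since i \<le> \<open>n div 2\<close>, the block \<beta> has length at least
    \<open>(n + 1) div 2\<close>.\<close>
  then show ?thesis
    using assms elevated_suffix[of \<beta> q "n - i" p \<alpha>] by (intro that[of "n - i" \<beta>]) auto
next
  assume "w \<in> setB q n"
  then obtain \<alpha> \<beta> i where "w = (1 # \<alpha>) @ \<beta>" "i \<le> n div 2 - 1" "\<beta> \<in> elevated q (n - i - 1)"
    by (auto simp: setB_def)
  then show ?thesis
    using assms elevated_suffix[of \<beta> q "n - i - 1" p "1 # \<alpha>"]
    by (intro that[of "n - i - 1" \<beta>]) auto
next
  assume "w \<in> setC q n"
  then obtain \<gamma> where \<gamma>: "w = \<gamma> @ [0]" "\<gamma> \<in> motzkin q (n - 1)"
    by (auto simp: setC_def)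
  obtain p' a where p': "p = p' @ [a]"
    using assms(4) by (cases p rule: rev_cases) auto
  then obtain u where "\<gamma> = u @ p'" "a = 0"
    using assms(3) \<gamma>(1) by (auto simp: suffix_def)
  \<comment> \<open>In \<open>setC\<close> the hypothesis on the height is never met: the final fall
    makes every non-empty suffix negative.\<close>
  then have "height p < 0"
    using \<gamma>(2) p' by (auto simp: motzkin_iff step_def dest: spec[of _ u])
  then show ?thesis
    using assms(5) by simp
qed

lemma CBFS_prefix_height:
  assumes "2 \<le> q" "2 \<le> n" "w \<in> CBFS q n" "strict_prefix p w"
  shows "0 \<le> height p"
  using assms(3) unfolding CBFS_def
proof (elim UnE)
  assume "w \<in> setA q n"
  then show ?thesis
    using setA_motzkin[OF assms(1)] assms(4) by (auto simp: motzkin_iff strict_prefix_def)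
next
  assume "w \<in> setB q n"
  then obtain \<gamma> where "w = 1 # \<gamma>" "\<gamma> \<in> motzkin q (n - 1)"
    using setB_motzkin[OF assms(1,2)] by blast
  then show ?thesis
    using assms(4)
    by (cases p) (auto simp: motzkin_iff strict_prefix_def step_def add_increasing)
next
  assume "w \<in> setC q n"
  then show ?thesis
    using assms(4) by (auto simp: setC_def motzkin_iff strict_prefix_def)
qed

lemma CBFS_zero_prefix_not_elevated:
  assumes "2 \<le> q" "2 \<le> n" "w \<in> CBFS q n" "strict_prefix p w" "p \<noteq> []" "height p = 0"
    and "(n + 1) div 2 \<le> j" "\<beta> \<in> elevated q j" "suffix \<beta> p"
  shows False
  using assms(3) unfolding CBFS_def
proof (elim UnE)
  assume w: "w \<in> setA q n"
  then obtain \<alpha> \<beta>' i where A: "w = \<alpha> @ \<beta>'" "i \<le> n div 2" "\<alpha> \<in> motzkin q i"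
    "\<beta>' \<in> elevated q (n - i)"
    by (auto simp: setA_def)
  have "prefix p \<alpha>"
    using motzkin_elevated_zero_prefix A assms(4,6) by blast
  moreover have "length \<alpha> = i"
    using A(3) by (simp add: motzkin_def words_def)
  moreover have "length p \<le> length \<alpha>" "length \<beta> \<le> length p" "length \<beta> = j"
    using \<open>prefix p \<alpha>\<close> assms(8,9) prefix_length_le suffix_length_le elevated_length by blast+
  \<comment> \<open>The chain \<open>(n + 1) div 2\<close> \<le> j \<le> \<open>length p\<close>
    \<le> i \<le> \<open>n div 2\<close> must collapse, which also forces \<open>n\<close> to be
    even.\<close>
  ultimately have "length \<beta> = length p" "length p = length \<alpha>" "j = n div 2" "i = n div 2" "even n"
    using A(2) assms(7) by (presburger+)
  then have "\<beta> = \<alpha>" "n - i = n div 2"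
    using \<open>prefix p \<alpha>\<close> assms(9) by (auto simp: prefix_def suffix_def)
  \<comment> \<open>Now \<alpha> = \<beta> and \<beta>' are both elevated of length
    \<open>n div 2\<close>, so \<open>w\<close> lies in the removed set.\<close>
  then show False
    using w A assms(8) \<open>j = n div 2\<close> \<open>even n\<close> by (auto simp: setA_def)
next
  assume "w \<in> setB q n"
  then obtain \<gamma> where \<gamma>: "w = 1 # \<gamma>" "\<gamma> \<in> motzkin q (n - 1)"
    using setB_motzkin[OF assms(1,2)] by blast
  then obtain p' where "p = 1 # p'" "prefix p' \<gamma>"
    using assms(4,5) by (cases p) (auto simp: strict_prefix_def)
  then show False
    using \<gamma>(2) assms(6) by (auto simp: motzkin_iff step_def)
next
  assume "w \<in> setC q n"
  then obtain \<gamma> where \<gamma>: "w = \<gamma> @ [0]"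
    "\<nexists>u \<beta> v j. (n + 1) div 2 \<le> j \<and> \<beta> \<in> elevated q j \<and> \<gamma> = u @ \<beta> @ v"
    by (auto simp: setC_def)
  \<comment> \<open>A strict prefix misses the final fall, so every suffix of \<open>p\<close> is a
    factor of \<gamma>.\<close>
  have "prefix p \<gamma>"
    using assms(4) \<gamma>(1) by (auto simp: strict_prefix_def)
  then obtain u v where "\<gamma> = u @ \<beta> @ v"
    using assms(9) by (auto simp: prefix_def suffix_def)
  then show False
    using \<gamma>(2) assms(7,8) by blast
qed

text \<open>The case \<open>w = w'\<close> is included, so that bifix-freeness and
  cross-bifix-freeness both follow.\<close>

lemma CBFS_no_overlap:
  assumes "2 \<le> q" "2 \<le> n" "w \<in> CBFS q n" "w' \<in> CBFS q n"
  shows "\<not> (\<exists>p. p \<noteq> [] \<and> strict_prefix p w \<and> suffix p w')"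
proof (intro notI, elim exE conjE)
  fix p assume p: "p \<noteq> []" "strict_prefix p w" "suffix p w'"
  \<comment> \<open>All words have length \<open>n\<close>, so a strict prefix of \<open>w\<close>
    is too short to be all of \<open>w'\<close>.\<close>
  have "length p < length w'"
    using prefix_length_less[OF p(2)] CBFS_words[OF assms(1,2)] assms(3,4) by (simp add: words_def)
  then have "strict_suffix p w'"
    using p(3) by (auto simp: strict_suffix_def)
  then have "height p = 0"
    using CBFS_suffix_height[OF assms(1,2,4)] CBFS_prefix_height[OF assms(1-3) p(2)] by force
  then obtain \<beta> j where "(n + 1) div 2 \<le> j" "\<beta> \<in> elevated q j" "suffix \<beta> p"
    using CBFS_suffix_elevated[OF assms(2,4) p(3,1)] by (metis order_refl)
  then show False
    using CBFS_zero_prefix_not_elevated[OF assms(1-3) p(2,1) \<open>height p = 0\<close>] by blast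
qed

theorem proposition3p1:
  fixes q n :: nat
  assumes "q \<ge> 3" and "n \<ge> 3"
  shows "cross_bifix_free_set q n (CBFS q n)"
proof -
  have "2 \<le> q" "2 \<le> n"
    using assms by auto
  note words = CBFS_words[OF this] and no_overlap = CBFS_no_overlap[OF this]
  have "CBFS q n \<subseteq> BF q n"
    using words no_overlap by (auto simp: BF_def bifix_free_def)
  then show ?thesis
    using no_overlap unfolding cross_bifix_free_set_def cross_bifix_free_def by blast
qed

end
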